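(* Suppose that $S(A,b)\neq\emptyset$. Suppose that $\overline{X}$ is an optimal solution of the problem $\min\{Z_1=\sum_{j=1}^{n}c_j^{-}x_j : x\in S(A,b)\}$ and that, for some $e^*\in E$, $\underline{X}(e^* )$ is an optimal solution of the problem $\min\{Z_2=\sum_{j=1}^{n}c_j^{+}x_j : x\in S(A,b)\}$. Define $x^*=[x_1^*,\dots,x_n^*]$ by $x_j^*=\overline{X}_j$ if $c_j<0$ and $x_j^*=\underline{X}(e^* )_j$ if $c_j\ge 0$, for $j=1,\dots,n$. Then $x^*$ is optimal for the problem $\min\{\sum_{j=1}^{n}c_jx_j : x\in S(A,b)\}$ (that is, $x^*\in S(A,b)$ and $\sum_{j}c_jx^*_j\le\sum_j c_jx_j$ for all $x\in S(A,b)$).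
   Context: Let $I=\{1,\dots,m\}$ and $J=\{1,\dots,n\}$ with $m,n\ge 1$. Let $A=(a_{ij})_{m\times n}$ be a matrix with entries in $[0,1]$ with $i$-th row $a_i$, let $b=(b_i)_{m\times 1}$ be a vector with entries in $[0,1]$, and let $c=(c_1,\dots,c_n)\in\mathbb{R}^n$, with $c_j^{+}=\max\{c_j,0\}$ and $c_j^{-}=\min\{c_j,0\}$. Let $w\in(0,1)$ and $p>0$ be real numbers. For $x,y\in[0,1]$ put $\varphi(x,y)=\left(w x^{p}+(1-w)y^{p}\right)^{1/p}$ (weighted power mean). For $x\in[0,1]^n$ put $\varphi(a_i,x)=\max_{j\in J}\varphi(a_{ij},x_j)$, let $S(a_i,b_i)=\{x\in[0,1]^n:\varphi(a_i,x)=b_i\}$ and $S(A,b)=\bigcap_{i\in I}S(a_i,b_i)$. For $i\in I$ define $J^{-}(i)=\{j\in J: a_{ij}>b_i/\sqrt[p]{w}\}$, $J^{\infty}(i)=\{j\in J: b_i^{p}\ge 1-w,\ a_{ij}<[(b_i^{p}+w-1)/w]^{1/p}\}$ and $J(i)=J\setminus(J^{-}(i)\cup J^{\infty}(i))$. When $S(a_i,b_i)\neq\emptyset$ (in which case $J^{-}(i)=\emptyset$), define $\overline{X}(i)\in[0,1]^n$ by $\overline{X}(i)_j=\left(\frac{b_i^{p}-w a_{ij}^{p}}{1-w}\right)^{1/p}$ if $j\in J(i)$ and $\overline{X}(i)_j=1$ if $j\in J^{\infty}(i)$; and for each $j\in J(i)$ define $\underline{X}(i,j)\in[0,1]^n$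 by $\underline{X}(i,j)_k=\left(\frac{b_i^{p}-w a_{ij}^{p}}{1-w}\right)^{1/p}$ if $k=j$ and $\underline{X}(i,j)_k=0$ otherwise. (If $S(A,b)\ne\emptyset$, then all $S(a_i,b_i)$ are nonempty, so these are defined for all $i$.) Let $\overline{X}=\min_{i\in I}\overline{X}(i)$ (componentwise minimum). Let $E$ be the set of all functions $e:I\to\bigcup_{i\in I}J(i)$ with $e(i)\in J(i)$ for all $i\in I$; for $e\in E$ let $\underline{X}(e)\in[0,1]^n$ be given by $\underline{X}(e)_j=\max_{i\in I}\underline{X}(i,e(i))_j$ for $j\in J$. *)

theory Defs
  imports "HOL-Analysis.Analysis"
begin

text \<open>
  The index sets \<open>I\<close> and \<open>J\<close> are the universes of the finite types \<open>'m\<close> and \<open>'n\<close>; the rows of a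
  matrix \<open>A :: real^'n^'m\<close> are \<open>A $ i\<close>. All powers have positive exponents (\<open>p\<close> or \<open>1 / p\<close> with
  \<open>p > 0\<close>), and the relevant bases are nonnegative, so \<open>powr\<close> is the ordinary power,
  including \<open>0 powr p = 0\<close>.
\<close>

definition wpm :: "real \<Rightarrow> real \<Rightarrow> real \<Rightarrow> real \<Rightarrow> real" where
  "wpm w p x y = (w * x powr p + (1 - w) * y powr p) powr (1 / p)"

definition max_wpm :: "real \<Rightarrow> real \<Rightarrow> real^'n \<Rightarrow> real^'n \<Rightarrow> real" where
  "max_wpm w p a x = Max ((\<lambda>j. wpm w p (a $ j) (x $ j)) ` UNIV)"

definition unit_cube :: "(real^'n) set" where
  "unit_cube = {x. \<forall>j. 0 \<le> x $ j \<and> x $ j \<le> 1}"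

definition S_row :: "real \<Rightarrow> real \<Rightarrow> real^'n \<Rightarrow> real \<Rightarrow> (real^'n) set" where
  "S_row w p a \<beta> = {x \<in> unit_cube. max_wpm w p a x = \<beta>}"

definition S :: "real \<Rightarrow> real \<Rightarrow> real^'n^'m \<Rightarrow> real^'m \<Rightarrow> (real^'n) set" where
  "S w p A b = (\<Inter>i. S_row w p (A $ i) (b $ i))"

definition J_minus :: "real \<Rightarrow> real \<Rightarrow> real^'n^'m \<Rightarrow> real^'m \<Rightarrow> 'm \<Rightarrow> 'n set" where
  "J_minus w p A b i = {j. A $ i $ j > b $ i / w powr (1 / p)}"

definition J_inf :: "real \<Rightarrow> real \<Rightarrow> real^'n^'m \<Rightarrow> real^'m \<Rightarrow> 'm \<Rightarrow> 'n set" where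
  "J_inf w p A b i =
     {j. (b $ i) powr p \<ge> 1 - w \<and> A $ i $ j < (((b $ i) powr p + w - 1) / w) powr (1 / p)}"

definition J_row :: "real \<Rightarrow> real \<Rightarrow> real^'n^'m \<Rightarrow> real^'m \<Rightarrow> 'm \<Rightarrow> 'n set" where
  "J_row w p A b i = UNIV - (J_minus w p A b i \<union> J_inf w p A b i)"

text \<open>
  The vectors \<open>X_upper_row\<close> and \<open>X_lower_row\<close> are meaningful only if \<open>S_row w p (A $ i) (b $ i)\<close>
  is nonempty, in which case \<open>J_minus w p A b i = {}\<close>; then the \<open>else\<close> branch of
  \<open>X_upper_row\<close> is exactly the case \<open>j \<in> J_inf w p A b i\<close>. Moreover \<open>X_lower_row w p A b i j\<close>
  is meaningful only for \<open>j \<in> J_row w p A b i\<close>.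
\<close>

definition X_upper_row :: "real \<Rightarrow> real \<Rightarrow> real^'n^'m \<Rightarrow> real^'m \<Rightarrow> 'm \<Rightarrow> real^'n" where
  "X_upper_row w p A b i =
     (\<chi> j. if j \<in> J_row w p A b i
           then (((b $ i) powr p - w * (A $ i $ j) powr p) / (1 - w)) powr (1 / p)
           else 1)"

definition X_lower_row :: "real \<Rightarrow> real \<Rightarrow> real^'n^'m \<Rightarrow> real^'m \<Rightarrow> 'm \<Rightarrow> 'n \<Rightarrow> real^'n" where
  "X_lower_row w p A b i j =
     (\<chi> k. if k = j
           then (((b $ i) powr p - w * (A $ i $ j) powr p) / (1 - w)) powr (1 / p)
           else 0)"

definition X_upper :: "real \<Rightarrow> real \<Rightarrow> real^'n^'m \<Rightarrow> real^'m \<Rightarrow> real^'n" where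
  "X_upper w p A b = (\<chi> j. Min ((\<lambda>i. X_upper_row w p A b i $ j) ` UNIV))"

definition E :: "real \<Rightarrow> real \<Rightarrow> real^'n^'m \<Rightarrow> real^'m \<Rightarrow> ('m \<Rightarrow> 'n) set" where
  "E w p A b = {e. \<forall>i. e i \<in> J_row w p A b i}"

definition X_lower :: "real \<Rightarrow> real \<Rightarrow> real^'n^'m \<Rightarrow> real^'m \<Rightarrow> ('m \<Rightarrow> 'n) \<Rightarrow> real^'n" where
  "X_lower w p A b e = (\<chi> j. Max ((\<lambda>i. X_lower_row w p A b i (e i) $ j) ` UNIV))"

definition optimal_solution :: "('a \<Rightarrow> real) \<Rightarrow> 'a set \<Rightarrow> 'a \<Rightarrow> bool" where
  "optimal_solution f F x \<longleftrightarrow> x \<in> F \<and> (\<forall>y\<in>F. f x \<le> f y)"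

end

theory Submission
  imports Defs
begin

text \<open>
  Each equation of the system says that a maximum of functions, every one of them nondecreasing in
  a single coordinate, takes a prescribed value. Hence the feasible set is order convex
  (\<open>S_order_convex\<close>): a point lying componentwise between two solutions is squeezed into
  being a solution. Moreover \<open>X_upper\<close> bounds every solution from above
  (\<open>solution_le_X_upper\<close>), because \<open>wpm w p a x \<le> \<beta>\<close> can be solved for \<open>x\<close>.

  The two optimality hypotheses make \<open>X_upper\<close> and \<open>X_lower\<close> solutions, so \<open>X_lower \<le> X_upper\<close>, and
  the combined point, which takes each coordinate from one of the two, lies between them and is a
  solution. For its cost, split \<open>c = min c 0 + max c 0\<close>. The negative part only sees the
  coordinates taken from \<open>X_upper\<close>, the positive part only those taken from \<open>X_lower\<close>, so the combined
  point attains the minimum of both partial costs at once, hence the minimum of their sum.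
\<close>

lemma wpm_mono:
  assumes "0 \<le> w" "w \<le> 1" "0 < p" "0 \<le> x" "x \<le> y"
  shows "wpm w p a x \<le> wpm w p a y"
  unfolding wpm_def using assms
  by (intro powr_mono2 add_left_mono mult_left_mono add_nonneg_nonneg) auto

lemma max_wpm_mono:
  fixes a x y :: "real^'n"
  assumes w: "0 \<le> w" "w \<le> 1" and p: "0 < p" and x: "\<And>j. 0 \<le> x $ j" and le: "x \<le> y"
  shows "max_wpm w p a x \<le> max_wpm w p a y"
proof -
  have "wpm w p (a $ j) (x $ j) \<le> Max (range (\<lambda>j. wpm w p (a $ j) (y $ j)))" for j
  proof -
    have "wpm w p (a $ j) (x $ j) \<le> wpm w p (a $ j) (y $ j)"
      using w p x le by (intro wpm_mono) (auto simp: less_eq_vec_def)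
    also have "\<dots> \<le> Max (range (\<lambda>j. wpm w p (a $ j) (y $ j)))"
      by (intro Max_ge) auto
    finally show ?thesis .
  qed
  then show ?thesis
    by (auto simp: max_wpm_def)
qed

text \<open>
  Monotonicity traps the value of \<open>max_wpm\<close> at the middle point between two equal values.
\<close>

lemma S_row_order_convex:
  fixes x y z :: "real^'n"
  assumes w: "0 \<le> w" "w \<le> 1" and p: "0 < p"
    and x: "x \<in> S_row w p a \<beta>" and z: "z \<in> S_row w p a \<beta>" and le: "x \<le> y" "y \<le> z"
  shows "y \<in> S_row w p a \<beta>"
proof -
  have x0: "0 \<le> x $ j" for j
    using x by (simp add: S_row_def unit_cube_def)
  have z1: "z $ j \<le> 1" for j
    using z by (simp add: S_row_def unit_cube_def)
  have y01: "0 \<le> y $ j" "y $ j \<le> 1" for j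
    using x0 z1 le order_trans unfolding less_eq_vec_def by blast+
  have "max_wpm w p a x \<le> max_wpm w p a y" "max_wpm w p a y \<le> max_wpm w p a z"
    using w p x0 y01 le by (auto intro: max_wpm_mono)
  then show ?thesis
    using x z y01 by (simp add: S_row_def unit_cube_def)
qed

lemma S_order_convex:
  fixes x y z :: "real^'n"
  assumes "0 \<le> w" "w \<le> 1" "0 < p" "x \<in> S w p A b" "z \<in> S w p A b" "x \<le> y" "y \<le> z"
  shows "y \<in> S w p A b"
  using assms S_row_order_convex[of w p x _ _ z y] by (auto simp: S_def)

text \<open>
  Raising \<open>wpm w p a x \<le> \<beta>\<close> to the \<open>p\<close>-th power turns it into a linear inequality
  in \<open>x powr p\<close>.
\<close>

lemma wpm_le_imp_le:
  assumes w: "0 \<le> w" "w < 1" and p: "0 < p" and x: "0 \<le> x" and le: "wpm w p a x \<le> \<beta>"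
  shows "x \<le> ((\<beta> powr p - w * a powr p) / (1 - w)) powr (1 / p)"
proof -
  have "wpm w p a x powr p = w * a powr p + (1 - w) * x powr p"
    using w p by (simp add: wpm_def powr_powr)
  moreover have "wpm w p a x powr p \<le> \<beta> powr p"
    using le p by (intro powr_mono2) (auto simp: wpm_def)
  ultimately have "x powr p \<le> (\<beta> powr p - w * a powr p) / (1 - w)"
    using w by (simp add: pos_le_divide_eq algebra_simps)
  then have "(x powr p) powr (1 / p) \<le> ((\<beta> powr p - w * a powr p) / (1 - w)) powr (1 / p)"
    using p by (intro powr_mono2) auto
  then show ?thesis
    using p x by (simp add: powr_powr)
qed

text \<open>
  In row \<open>i\<close> a coordinate in \<open>J_row\<close> is limited by the equation through
  \<open>wpm_le_imp_le\<close>, and any other coordinate by the unit cube.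
\<close>

lemma solution_le_X_upper:
  fixes x :: "real^'n"
  assumes w: "0 \<le> w" "w < 1" and p: "0 < p" and x: "x \<in> S w p A b"
  shows "x \<le> X_upper w p A b"
proof -
  have "x $ j \<le> X_upper_row w p A b i $ j" for i j
  proof -
    have row: "x \<in> S_row w p (A $ i) (b $ i)"
      using x by (simp add: S_def)
    then have x01: "0 \<le> x $ j" "x $ j \<le> 1"
      by (auto simp: S_row_def unit_cube_def)
    have "wpm w p (A $ i $ j) (x $ j) \<le> max_wpm w p (A $ i) x"
      unfolding max_wpm_def by (intro Max_ge) auto
    then have "wpm w p (A $ i $ j) (x $ j) \<le> b $ i"
      using row by (simp add: S_row_def)
    then show ?thesis
      using wpm_le_imp_le[OF w p x01(1)] x01(2) by (simp add: X_upper_row_def)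
  qed
  then show ?thesis
    by (simp add: less_eq_vec_def X_upper_def)
qed

lemma optimal_solution_add:
  assumes "optimal_solution f F x" "optimal_solution g F x"
  shows "optimal_solution (\<lambda>y. f y + g y) F x"
  using assms by (auto simp: optimal_solution_def intro: add_mono)

theorem corollary4:
  fixes A :: "real^'n^'m" and b :: "real^'m" and c :: "real^'n"
    and w p :: real and e :: "'m \<Rightarrow> 'n"
  assumes "0 < w" and "w < 1" and "0 < p"
    and "\<And>i j. 0 \<le> A $ i $ j \<and> A $ i $ j \<le> 1"
    and "\<And>i. 0 \<le> b $ i \<and> b $ i \<le> 1"
    and "S w p A b \<noteq> {}"
    and "optimal_solution (\<lambda>x. \<Sum>j\<in>UNIV. min (c $ j) 0 * x $ j) (S w p A b) (X_upper w p A b)"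
    and "e \<in> E w p A b"
    and "optimal_solution (\<lambda>x. \<Sum>j\<in>UNIV. max (c $ j) 0 * x $ j) (S w p A b) (X_lower w p A b e)"
  shows "optimal_solution (\<lambda>x. \<Sum>j\<in>UNIV. c $ j * x $ j) (S w p A b)
           (\<chi> j. if c $ j < 0 then X_upper w p A b $ j else X_lower w p A b e $ j)"
proof -
  let ?F = "S w p A b" and ?u = "X_upper w p A b" and ?l = "X_lower w p A b e"
  let ?neg = "\<lambda>x :: real^'n. \<Sum>j\<in>UNIV. min (c $ j) 0 * x $ j"
  let ?pos = "\<lambda>x :: real^'n. \<Sum>j\<in>UNIV. max (c $ j) 0 * x $ j"
  define x where "x = (\<chi> j. if c $ j < 0 then ?u $ j else ?l $ j)"
  have u: "?u \<in> ?F" and l: "?l \<in> ?F"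
    using assms(7,9) by (simp_all add: optimal_solution_def)
  have "?l \<le> ?u"
    using assms(1-3) l by (intro solution_le_X_upper) auto
  then have "?l \<le> x" "x \<le> ?u"
    by (auto simp: x_def less_eq_vec_def)
  then have x: "x \<in> ?F"
    using S_order_convex[OF _ _ _ l u] assms(1-3) by simp
  have neg: "?neg x = ?neg ?u" and pos: "?pos x = ?pos ?l"
    by (auto simp: x_def intro!: sum.cong)
  have "optimal_solution ?neg ?F x" "optimal_solution ?pos ?F x"
    using assms(7,9) x unfolding optimal_solution_def neg pos by blast+
  then have "optimal_solution (\<lambda>y. ?neg y + ?pos y) ?F x"
    by (rule optimal_solution_add)
  moreover have "?neg y + ?pos y = (\<Sum>j\<in>UNIV. c $ j * y $ j)" for y
    unfolding sum.distrib[symmetric] by (rule sum.cong) (auto simp: min_def max_def)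
  ultimately show ?thesis
    by (simp add: x_def)
qed

end
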